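(* Let $\Omega\subseteq\mathbb{R}^d$ be nonempty, closed and convex. Let $y:[t_0,\infty)\to\Omega$ and $\delta,\alpha_1:[t_0,\infty)\to(0,\infty)$ be locally absolutely continuous functions such that $$\delta(t)<\tfrac14\left(\alpha_1(t)^2+2\alpha_1'(t)\right)\quad\text{for all } t\ge t_0.$$ Let $x_0,x_1\in\Omega$ and let $x:[t_0,\infty)\to\mathbb{R}^d$ be a solution of $$x''(t)+\alpha_1(t)x'(t)=\delta(t)[y(t)-x(t)],\qquad x(t_0)=x_0,\qquad x'(t_0)=\tfrac14\alpha_1(t_0)(x_1-x_0).$$ Then $x(t)\in\Omega$ for all $t\ge t_0$.
   Context: Here $t_0\ge 0$. Locally absolutely continuous on $[t_0,\infty)$ means absolutely continuous on each compact subinterval. *)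

theory Defs
  imports "HOL-Analysis.Analysis"
begin

text \<open>A pair \<open>(u, v)\<close> in \<open>D\<close> stands for the interval with endpoints \<open>u \<le> v\<close>.\<close>

definition abs_cont_on_interval ::
    "real \<Rightarrow> real \<Rightarrow> (real \<Rightarrow> 'a::real_normed_vector) \<Rightarrow> bool" where
  "abs_cont_on_interval a b f \<longleftrightarrow>
     (\<forall>\<epsilon>>0. \<exists>\<eta>>0. \<forall>D :: (real \<times> real) set.
        finite D \<longrightarrow>
        (\<forall>(u, v)\<in>D. a \<le> u \<and> u \<le> v \<and> v \<le> b) \<longrightarrow>
        pairwise (\<lambda>p q. disjnt {fst p<..<snd p} {fst q<..<snd q}) D \<longrightarrow>
        (\<Sum>(u, v)\<in>D. v - u) < \<eta> \<longrightarrow>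
        (\<Sum>(u, v)\<in>D. norm (f v - f u)) < \<epsilon>)"

definition loc_abs_cont_from :: "real \<Rightarrow> (real \<Rightarrow> 'a::real_normed_vector) \<Rightarrow> bool" where
  "loc_abs_cont_from t0 f \<longleftrightarrow>
     (\<forall>a b. t0 \<le> a \<longrightarrow> a \<le> b \<longrightarrow> abs_cont_on_interval a b f)"

text \<open>
  Solutions on \<open>[t0, \<infinity>)\<close> of the equation \<open>x'' + \<alpha> x' = \<delta> (y - x)\<close>, in the sense of
  Caratheodory: \<open>x\<close> is differentiable with derivative \<open>x'\<close> (one-sided at \<open>t0\<close>), \<open>x'\<close> is locally
  absolutely continuous, and the equation holds almost everywhere. Every twice differentiable
  function satisfying the equation at all \<open>t \<ge> t0\<close> is of this kind when \<open>\<alpha>\<close>, \<open>\<delta>\<close> and \<open>y\<close> are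
  continuous, since \<open>x''\<close> is then continuous.
\<close>

definition ode_solution ::
    "real \<Rightarrow> (real \<Rightarrow> real) \<Rightarrow> (real \<Rightarrow> real) \<Rightarrow> (real \<Rightarrow> 'a::real_normed_vector) \<Rightarrow>
     (real \<Rightarrow> 'a) \<Rightarrow> (real \<Rightarrow> 'a) \<Rightarrow> bool" where
  "ode_solution t0 \<alpha> \<delta> y x x' \<longleftrightarrow>
     (\<forall>t\<ge>t0. (x has_vector_derivative x' t) (at t within {t0..})) \<and>
     loc_abs_cont_from t0 x' \<and>
     (AE t in lebesgue. t \<ge> t0 \<longrightarrow>
        (\<exists>x''. (x' has_vector_derivative x'') (at t within {t0..}) \<and>
               x'' + \<alpha> t *\<^sub>R x' t = \<delta> t *\<^sub>R (y t - x t)))"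

text \<open>
  A locally absolutely continuous \<open>\<alpha>\<close> has a derivative only almost everywhere, so the bound
  on \<open>\<delta>\<close> involving \<open>\<alpha>'\<close> is imposed for almost every \<open>t \<ge> t0\<close>. The differentiability conjunct
  only keeps \<^const>\<open>vector_derivative\<close> from being used where it has no meaning.
\<close>

definition damping_condition :: "real \<Rightarrow> (real \<Rightarrow> real) \<Rightarrow> (real \<Rightarrow> real) \<Rightarrow> bool" where
  "damping_condition t0 \<alpha> \<delta> \<longleftrightarrow>
     (AE t in lebesgue. t \<ge> t0 \<longrightarrow>
        \<alpha> differentiable (at t within {t0..}) \<and>
        \<delta> t < 1/4 * ((\<alpha> t)\<^sup>2 + 2 * vector_derivative \<alpha> (at t within {t0..})))"

end

theory Submission
  imports Defs
begin

text \<open>A point \<open>x \<tau> \<notin> \<Omega>\<close> is separated strictly from \<open>\<Omega>\<close> by a hyperplane, which gives a scalar function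
  \<open>u = c \<bullet> x - \<beta>\<close> with \<open>u'' + \<alpha>\<^sub>1 u' + \<delta> u \<ge> 0\<close>, \<open>u(t\<^sub>0) > 0\<close> and \<open>u(\<tau>) < 0\<close>. For
  \<open>v = u' + \<alpha>\<^sub>1 u / 2\<close> one has \<open>v' \<ge> (\<alpha>\<^sub>1\<^sup>2/4 + \<alpha>\<^sub>1'/2 - \<delta>) u - \<alpha>\<^sub>1 v / 2\<close>, and the bracket is positive
  by the damping condition. Hence up to a first zero of \<open>u\<close> the function \<open>v\<close>, which is positive at \<open>t\<^sub>0\<close>
  by the choice of \<open>x'(t\<^sub>0)\<close>, stays positive. But then \<open>u' \<ge> - \<alpha>\<^sub>1 u / 2\<close>, which keeps \<open>u\<close> positive at
  that zero.\<close>

section \<open>Closure properties of absolute continuity on an interval\<close>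

lemma abs_cont_on_intervalE:
  fixes f :: "real \<Rightarrow> 'a::real_normed_vector"
  assumes "abs_cont_on_interval a b f" "e > 0"
  obtains \<eta> where "\<eta> > 0" "\<And>D :: (real \<times> real) set. finite D \<Longrightarrow>
        (\<forall>(u, v)\<in>D. a \<le> u \<and> u \<le> v \<and> v \<le> b) \<Longrightarrow>
        pairwise (\<lambda>p q. disjnt {fst p<..<snd p} {fst q<..<snd q}) D \<Longrightarrow>
        (\<Sum>(u, v)\<in>D. v - u) < \<eta> \<Longrightarrow> (\<Sum>(u, v)\<in>D. norm (f v - f u)) < e"
proof -
  note * = assms(1)[unfolded abs_cont_on_interval_def, THEN spec, THEN mp, OF assms(2)]
  show thesis
  proof (rule exE[OF *], elim conjE)
    fix \<eta> :: real
    assume "\<eta> > 0" and D: "\<forall>D :: (real \<times> real) set. finite D \<longrightarrow>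
        (\<forall>(u, v)\<in>D. a \<le> u \<and> u \<le> v \<and> v \<le> b) \<longrightarrow>
        pairwise (\<lambda>p q. disjnt {fst p<..<snd p} {fst q<..<snd q}) D \<longrightarrow>
        (\<Sum>(u, v)\<in>D. v - u) < \<eta> \<longrightarrow> (\<Sum>(u, v)\<in>D. norm (f v - f u)) < e"
    show thesis
      by (rule that[OF \<open>\<eta> > 0\<close> D[THEN spec, THEN mp, THEN mp, THEN mp, THEN mp]])
  qed
qed

text \<open>The increment bound is summed over \<open>D\<close>, so one \<open>\<eta>\<close>
  serving both \<open>g\<close> and \<open>h\<close> serves \<open>f\<close>. Sums, products, inner
  products and Lipschitz functions all reduce to this comparison.\<close>

lemma abs_cont_dominated:
  assumes g: "abs_cont_on_interval a b g" and h: "abs_cont_on_interval a b h"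
    and le: "\<And>u v. a \<le> u \<Longrightarrow> u \<le> v \<Longrightarrow> v \<le> b \<Longrightarrow>
               norm (f v - f u) \<le> M * norm (g v - g u) + M * norm (h v - h u)"
  shows "abs_cont_on_interval a b f"
  unfolding abs_cont_on_interval_def
proof (intro allI impI)
  fix e :: real assume "e > 0"
  \<comment> \<open>Both sums get the budget \<open>e'\<close>, and the factor
    \<open>\<bar>M\<bar> + 1\<close> turns their total into exactly \<open>e\<close>. The added 1
    keeps the denominator positive, and the absolute value covers a negative
    \<open>M\<close>.\<close>
  define e' where "e' = e / (2 * (\<bar>M\<bar> + 1))"
  have e': "e' > 0" and Me': "(\<bar>M\<bar> + 1) * e' = e / 2"
    using \<open>e > 0\<close> by (auto simp: e'_def field_simps add_nonneg_pos)
  obtain \<eta>1 where \<eta>1: "\<eta>1 > 0" "\<And>D :: (real \<times> real) set. finite D \<Longrightarrow>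
        (\<forall>(u, v)\<in>D. a \<le> u \<and> u \<le> v \<and> v \<le> b) \<Longrightarrow>
        pairwise (\<lambda>p q. disjnt {fst p<..<snd p} {fst q<..<snd q}) D \<Longrightarrow>
        (\<Sum>(u, v)\<in>D. v - u) < \<eta>1 \<Longrightarrow> (\<Sum>(u, v)\<in>D. norm (g v - g u)) < e'"
    by (rule abs_cont_on_intervalE[OF g e']) (rule that)
  obtain \<eta>2 where \<eta>2: "\<eta>2 > 0" "\<And>D :: (real \<times> real) set. finite D \<Longrightarrow>
        (\<forall>(u, v)\<in>D. a \<le> u \<and> u \<le> v \<and> v \<le> b) \<Longrightarrow>
        pairwise (\<lambda>p q. disjnt {fst p<..<snd p} {fst q<..<snd q}) D \<Longrightarrow>
        (\<Sum>(u, v)\<in>D. v - u) < \<eta>2 \<Longrightarrow> (\<Sum>(u, v)\<in>D. norm (h v - h u)) < e'"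
    by (rule abs_cont_on_intervalE[OF h e']) (rule that)
  show "\<exists>\<eta>>0. \<forall>D :: (real \<times> real) set. finite D \<longrightarrow>
        (\<forall>(u, v)\<in>D. a \<le> u \<and> u \<le> v \<and> v \<le> b) \<longrightarrow>
        pairwise (\<lambda>p q. disjnt {fst p<..<snd p} {fst q<..<snd q}) D \<longrightarrow>
        (\<Sum>(u, v)\<in>D. v - u) < \<eta> \<longrightarrow> (\<Sum>(u, v)\<in>D. norm (f v - f u)) < e"
  proof (intro exI[of _ "min \<eta>1 \<eta>2"] conjI allI impI)
    fix D :: "(real \<times> real) set"
    assume D: "finite D" "\<forall>(u, v)\<in>D. a \<le> u \<and> u \<le> v \<and> v \<le> b"
      "pairwise (\<lambda>p q. disjnt {fst p<..<snd p} {fst q<..<snd q}) D"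
      "(\<Sum>(u, v)\<in>D. v - u) < min \<eta>1 \<eta>2"
    let ?G = "\<Sum>(u, v)\<in>D. norm (g v - g u)" and ?H = "\<Sum>(u, v)\<in>D. norm (h v - h u)"
    have "?G < e'" "?H < e'"
      using \<eta>1(2)[OF D(1-3)] \<eta>2(2)[OF D(1-3)] D(4) by auto
    then have GH: "?G + ?H < 2 * e'" by linarith
    have "(\<Sum>(u, v)\<in>D. norm (f v - f u)) \<le>
          (\<Sum>(u, v)\<in>D. (\<bar>M\<bar> + 1) * (norm (g v - g u) + norm (h v - h u)))"
    proof (rule sum_mono, clarify)
      fix u v assume "(u, v) \<in> D"
      then have "norm (f v - f u) \<le> M * (norm (g v - g u) + norm (h v - h u))"
        using D(2) le[of u v] by (auto simp: distrib_left)
      also have "\<dots> \<le> (\<bar>M\<bar> + 1) * (norm (g v - g u) + norm (h v - h u))"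
        by (intro mult_right_mono) auto
      finally show "norm (f v - f u) \<le> (\<bar>M\<bar> + 1) * (norm (g v - g u) + norm (h v - h u))" .
    qed
    also have "\<dots> = (\<bar>M\<bar> + 1) * (?G + ?H)"
      by (simp add: sum_distrib_left sum.distrib split_def distrib_left)
    also have "\<dots> < (\<bar>M\<bar> + 1) * (2 * e')"
      using GH by (intro mult_strict_left_mono) auto
    also have "\<dots> = e" using Me' by simp
    finally show "(\<Sum>(u, v)\<in>D. norm (f v - f u)) < e" .
  qed (use \<eta>1 \<eta>2 in auto)
qed

lemma abs_cont_Lipschitz:
  assumes "\<And>u v. a \<le> u \<Longrightarrow> u \<le> v \<Longrightarrow> v \<le> b \<Longrightarrow> norm (f v - f u) \<le> L * (v - u)"
  shows "abs_cont_on_interval a b f"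
proof -
  have id: "abs_cont_on_interval a b (\<lambda>t::real. t)"
    unfolding abs_cont_on_interval_def
  proof (intro allI impI)
    fix e :: real assume "e > 0"
    have "(\<Sum>(u, v)\<in>D. norm (v - u)) = (\<Sum>(u, v)\<in>D. v - u)"
      if "\<forall>(u, v)\<in>D. a \<le> u \<and> u \<le> v \<and> v \<le> b" for D :: "(real \<times> real) set"
      using that by (intro sum.cong) auto
    then show "\<exists>\<eta>>0. \<forall>D. finite D \<longrightarrow> (\<forall>(u, v)\<in>D. a \<le> u \<and> u \<le> v \<and> v \<le> b) \<longrightarrow>
        pairwise (\<lambda>p q. disjnt {fst p<..<snd p} {fst q<..<snd q}) D \<longrightarrow>
        (\<Sum>(u, v)\<in>D. v - u) < \<eta> \<longrightarrow> (\<Sum>(u, v)\<in>D. norm (v - u)) < e"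
      using \<open>e > 0\<close> by (intro exI[of _ e]) auto
  qed
  show ?thesis
    \<comment> \<open>The identity fills both slots of the comparison, so each carries half of
      \<open>L\<close>.\<close>
    by (rule abs_cont_dominated[OF id id, of _ "L/2"]) (use assms in auto)
qed

lemma abs_cont_add:
  assumes "abs_cont_on_interval a b f" "abs_cont_on_interval a b g"
  shows "abs_cont_on_interval a b (\<lambda>t. f t + g t)"
proof (rule abs_cont_dominated[OF assms])
  fix u v
  show "norm (f v + g v - (f u + g u)) \<le> 1 * norm (f v - f u) + 1 * norm (g v - g u)"
    using norm_triangle_ineq[of "f v - f u" "g v - g u"] by (simp add: algebra_simps)
qed

lemma abs_cont_inner_left:
  assumes "abs_cont_on_interval a b f"
  shows "abs_cont_on_interval a b (\<lambda>t. c \<bullet> f t)"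
proof (rule abs_cont_dominated[OF assms assms])
  fix u v
  show "norm (c \<bullet> f v - c \<bullet> f u) \<le> norm c / 2 * norm (f v - f u) + norm c / 2 * norm (f v - f u)"
    using Cauchy_Schwarz_ineq2[of c "f v - f u"] by (simp add: inner_diff_right)
qed

lemma abs_cont_imp_continuous_on:
  assumes "abs_cont_on_interval a b f"
  shows "continuous_on {a..b} f"
  unfolding continuous_on_iff
proof (intro ballI allI impI)
  fix s and e :: real assume s: "s \<in> {a..b}" and "e > 0"
  obtain \<eta> where \<eta>: "\<eta> > 0" "\<And>D :: (real \<times> real) set. finite D \<Longrightarrow>
        (\<forall>(u, v)\<in>D. a \<le> u \<and> u \<le> v \<and> v \<le> b) \<Longrightarrow>
        pairwise (\<lambda>p q. disjnt {fst p<..<snd p} {fst q<..<snd q}) D \<Longrightarrow>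
        (\<Sum>(u, v)\<in>D. v - u) < \<eta> \<Longrightarrow> (\<Sum>(u, v)\<in>D. norm (f v - f u)) < e"
    by (rule abs_cont_on_intervalE[OF assms \<open>e > 0\<close>]) (rule that)
  \<comment> \<open>A one-element \<open>D\<close> suffices; its pair must have ordered endpoints,
    hence the two candidates.\<close>
  have "dist (f r) (f s) < e" if r: "r \<in> {a..b}" and "dist r s < \<eta>" for r
    using \<eta>(2)[of "{(r, s)}"] \<eta>(2)[of "{(s, r)}"] r s that
    by (cases "r \<le> s") (auto simp: dist_norm norm_minus_commute)
  then show "\<exists>d>0. \<forall>r\<in>{a..b}. dist r s < d \<longrightarrow> dist (f r) (f s) < e"
    using \<eta>(1) by blast
qed

lemma abs_cont_bounded:
  assumes "abs_cont_on_interval a b f"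
  obtains F where "\<And>t. t \<in> {a..b} \<Longrightarrow> norm (f t) \<le> F"
  using compact_imp_bounded[OF compact_continuous_image[OF abs_cont_imp_continuous_on[OF assms]
      compact_Icc]]
  unfolding bounded_iff by blast

text \<open>Both factors are bounded on the compact interval, so splitting the increment of the
  product as in the product rule bounds it by the increments of the factors.\<close>

lemma abs_cont_mult:
  fixes f g :: "real \<Rightarrow> real"
  assumes f: "abs_cont_on_interval a b f" and g: "abs_cont_on_interval a b g"
  shows "abs_cont_on_interval a b (\<lambda>t. f t * g t)"
proof -
  obtain F where F: "\<And>t. t \<in> {a..b} \<Longrightarrow> \<bar>f t\<bar> \<le> F"
    using abs_cont_bounded[OF f] by auto
  obtain G where G: "\<And>t. t \<in> {a..b} \<Longrightarrow> \<bar>g t\<bar> \<le> G"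
    using abs_cont_bounded[OF g] by auto
  show ?thesis
  proof (rule abs_cont_dominated[OF f g])
    fix u v assume uv: "a \<le> u" "u \<le> v" "v \<le> b"
    have "f v * g v - f u * g u = (f v - f u) * g v + f u * (g v - g u)"
      by (simp add: algebra_simps)
    also have "norm \<dots> \<le> \<bar>f v - f u\<bar> * \<bar>g v\<bar> + \<bar>f u\<bar> * \<bar>g v - g u\<bar>"
      by (metis abs_mult abs_triangle_ineq real_norm_def)
    also have "\<dots> \<le> \<bar>f v - f u\<bar> * max F G + max F G * \<bar>g v - g u\<bar>"
      using F[of u] G[of v] uv by (intro add_mono mult_left_mono mult_right_mono) auto
    finally show "norm (f v * g v - f u * g u)
        \<le> max F G * norm (f v - f u) + max F G * norm (g v - g u)"
      by (simp add: mult.commute)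
  qed
qed

section \<open>Monotonicity from a nonnegative derivative almost everywhere\<close>

text \<open>Cousin's lemma: at good points the gauge comes from the derivative, and at points of the
  exceptional null set it keeps the interval inside a small open cover of that set, where absolute
  continuity bounds the total variation.\<close>

lemma abs_cont_increasing:
  fixes f :: "real \<Rightarrow> real"
  assumes "a \<le> b" and ac: "abs_cont_on_interval a b f"
    and ae: "AE t in lebesgue. t \<in> {a..b} \<longrightarrow>
               (\<exists>d\<ge>0. (f has_real_derivative d) (at t within {a..b}))"
  shows "f a \<le> f b"
proof (rule field_le_epsilon)
  fix e0 :: real assume "e0 > 0"
  \<comment> \<open>The total error \<open>e0\<close> is shared: \<open>e * (b - a)\<close> for
    intervals tagged at good points and \<open>e\<close> for those tagged in the null set. The added
    1 covers \<open>a = b\<close>.\<close>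
  define e where "e = e0 / (b - a + 1)"
  have e: "e > 0" and "e * (b - a + 1) = e0"
    using \<open>e0 > 0\<close> \<open>a \<le> b\<close> by (auto simp: e_def)
  then have ee: "e * (b - a) + e = e0" by (simp add: distrib_left)
  obtain \<eta> where \<eta>: "\<eta> > 0" "\<And>D :: (real \<times> real) set. finite D \<Longrightarrow>
        (\<forall>(u, v)\<in>D. a \<le> u \<and> u \<le> v \<and> v \<le> b) \<Longrightarrow>
        pairwise (\<lambda>p q. disjnt {fst p<..<snd p} {fst q<..<snd q}) D \<Longrightarrow>
        (\<Sum>(u, v)\<in>D. v - u) < \<eta> \<Longrightarrow> (\<Sum>(u, v)\<in>D. norm (f v - f u)) < e"
    by (rule abs_cont_on_intervalE[OF ac e]) (rule that)
  obtain N where "{t \<in> space lebesgue. \<not> (t \<in> {a..b} \<longrightarrow>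
      (\<exists>d\<ge>0. (f has_real_derivative d) (at t within {a..b})))} \<subseteq> N"
      "emeasure lebesgue N = 0" "N \<in> sets lebesgue"
    by (rule AE_E[OF ae]) (rule that)
  then have N: "N \<in> null_sets lebesgue"
    and good: "\<And>t. t \<in> {a..b} \<Longrightarrow> t \<notin> N \<Longrightarrow>
                 \<exists>d\<ge>0. (f has_real_derivative d) (at t within {a..b})"
    by (auto simp: null_sets_def)
  obtain U where U: "open U" "N \<subseteq> U" "U - N \<in> lmeasurable" "emeasure lebesgue (U - N) < ennreal \<eta>"
    using sets_lebesgue_outer_open[OF null_setsD2[OF N] \<open>\<eta> > 0\<close>] by blast
  have "emeasure lebesgue U = emeasure lebesgue (U - N)"
    by (metis N U(1) borel_open emeasure_Diff_null_set sets_completionI_sets sets_lborel)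
  then have emU: "emeasure lebesgue U < ennreal \<eta>" using U by simp
  then have Um: "U \<in> lmeasurable"
    using U(1) by (intro fmeasurableI) (auto simp: less_top[symmetric])
  have mU: "measure lebesgue U < \<eta>"
    using emU Um \<open>\<eta> > 0\<close> by (simp add: emeasure_eq_measure2 ennreal_less_iff)
  \<comment> \<open>The estimate is needed on each side of \<open>t\<close> separately, since a tag
    cuts its interval in two. A slope \<open>d \<ge> 0\<close> together with the error term leaves
    increments of at least \<open>- e\<close> times the length.\<close>
  have "\<exists>r>0. if t \<in> N then ball t r \<subseteq> U else
          t \<in> {a..b} \<longrightarrow> (\<forall>s\<in>{a..b}. \<bar>s - t\<bar> < r \<longrightarrow>
             (t \<le> s \<longrightarrow> f s - f t \<ge> - e * (s - t)) \<and> (s \<le> t \<longrightarrow> f t - f s \<ge> - e * (t - s)))" for t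
  proof -
    consider "t \<in> N" | "t \<notin> N" "t \<notin> {a..b}" | "t \<notin> N" "t \<in> {a..b}" by blast
    then show ?thesis
    proof cases
      case 1
      then obtain r where "r > 0" "ball t r \<subseteq> U"
        using U(1,2) openE by blast
      then show ?thesis using 1 by auto
    next
      case 2
      then show ?thesis by (intro exI[of _ 1]) auto
    next
      case 3
      then obtain d where d: "d \<ge> 0" "(f has_real_derivative d) (at t within {a..b})"
        using good by auto
      then obtain r where r: "r > 0" "\<And>s. s \<in> {a..b} \<Longrightarrow> norm (s - t) < r \<Longrightarrow>
          norm (f s - f t - d * (s - t)) \<le> e * norm (s - t)"
        using e unfolding has_field_derivative_def has_derivative_within_alt by blast
      have "(t \<le> s \<longrightarrow> f s - f t \<ge> - e * (s - t)) \<and> (s \<le> t \<longrightarrow> f t - f s \<ge> - e * (t - s))"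
        if s: "s \<in> {a..b}" "\<bar>s - t\<bar> < r" for s
      proof -
        have *: "\<bar>f s - f t - d * (s - t)\<bar> \<le> e * \<bar>s - t\<bar>" using r(2)[of s] s by simp
        show ?thesis
        proof (cases "t \<le> s")
          case True
          then have "d * (s - t) \<ge> 0" using d by simp
          with * True show ?thesis by (cases "s = t") (auto simp: abs_le_iff)
        next
          case False
          then have "d * (t - s) \<ge> 0" using d by simp
          with * False show ?thesis by (auto simp: abs_le_iff algebra_simps)
        qed
      qed
      then show ?thesis using 3 \<open>r > 0\<close> by auto
    qed
  qed
  then obtain r where "\<And>t. r t > 0 \<and> (if t \<in> N then ball t (r t) \<subseteq> U else
          t \<in> {a..b} \<longrightarrow> (\<forall>s\<in>{a..b}. \<bar>s - t\<bar> < r t \<longrightarrow>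
             (t \<le> s \<longrightarrow> f s - f t \<ge> - e * (s - t)) \<and> (s \<le> t \<longrightarrow> f t - f s \<ge> - e * (t - s))))"
    by metis
  then have r: "\<And>t. r t > 0" "\<And>t. t \<in> N \<Longrightarrow> ball t (r t) \<subseteq> U"
    "\<And>s t. t \<notin> N \<Longrightarrow> t \<in> {a..b} \<Longrightarrow> s \<in> {a..b} \<Longrightarrow> \<bar>s - t\<bar> < r t \<Longrightarrow>
             (t \<le> s \<longrightarrow> f s - f t \<ge> - e * (s - t)) \<and> (s \<le> t \<longrightarrow> f t - f s \<ge> - e * (t - s))"
    by (meson, meson, meson)
  have "gauge (\<lambda>t. ball t (r t))" using r(1) by (intro gauge_ball_dependent) auto
  then obtain p where p: "p tagged_division_of {a..b}" "(\<lambda>t. ball t (r t)) fine p"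
    using fine_division_exists_real by metis
  note pD = tagged_division_ofD[OF p(1)]
  have K: "Inf K \<le> t \<and> t \<le> Sup K \<and> a \<le> Inf K \<and> Sup K \<le> b \<and> K = {Inf K..Sup K} \<and> K \<subseteq> ball t (r t)"
    if tK: "(t, K) \<in> p" for t K
  proof -
    obtain u v where uv: "K = {u..v}" using pD(4)[OF tK] by auto
    with pD(2)[OF tK] have "u \<le> v" by auto
    with uv pD(2,3)[OF tK] p(2) tK show ?thesis by (auto simp: fine_def)
  qed
  \<comment> \<open>Degenerate intervals are left out so that the open intervals \<open>?J x\<close>
    are nonempty; being disjoint they are then distinct, which makes \<open>?g\<close> injective on
    \<open>B\<close>.\<close>
  define B where "B = {(t, K) \<in> p. t \<in> N \<and> Inf K < Sup K}"
  have "finite B" unfolding B_def using pD(1) by (rule rev_finite_subset) auto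
  let ?g = "\<lambda>(t::real, K). (Inf K :: real, Sup K :: real)"
  let ?J = "\<lambda>(t::real, K). {Inf K<..<Sup K :: real}"
  have BK: "(t, K) \<in> p" "t \<in> N" "Inf K < Sup K" if "(t, K) \<in> B" for t K
    using that by (auto simp: B_def)
  have dis: "disjnt (?J x) (?J y)" if xy: "x \<in> B" "y \<in> B" "x \<noteq> y" for x y
  proof -
    obtain t K s L where [simp]: "x = (t, K)" "y = (s, L)" by (cases x, cases y) auto
    have "interior K \<inter> interior L = {}" using pD(5)[of t K s L] xy BK by auto
    moreover have "interior K = {Inf K<..<Sup K}" "interior L = {Inf L<..<Sup L}"
      using K[of t K] K[of s L] BK xy by (metis interior_atLeastAtMost_real \<open>x = _\<close> \<open>y = _\<close>)+
    ultimately show ?thesis by (simp add: disjnt_def)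
  qed
  have ne: "?J x \<noteq> {}" if "x \<in> B" for x
    using that by (cases x) (auto simp: B_def)
  have inj: "inj_on ?g B"
  proof (rule inj_onI, rule ccontr)
    fix x y assume xy: "x \<in> B" "y \<in> B" "?g x = ?g y" "x \<noteq> y"
    then have "?J x = ?J y" by (auto simp: split_def)
    with dis[OF xy(1,2,4)] ne[OF xy(1)] show False by (auto simp: disjnt_def)
  qed
  have "(\<Sum>(u, v)\<in>?g ` B. v - u) = (\<Sum>(t, K)\<in>B. Sup K - Inf K)"
    by (subst sum.reindex[OF inj]) (auto simp: split_def)
  also have "\<dots> = (\<Sum>x\<in>B. measure lebesgue (?J x))"
    using BK by (intro sum.cong) (auto simp: less_imp_le)
  also have "\<dots> = measure lebesgue (\<Union>x\<in>B. ?J x)"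
  proof (rule measure_finite_Union[symmetric, OF \<open>finite B\<close>])
    show "?J ` B \<subseteq> sets lebesgue" by auto
    show "disjoint_family_on ?J B"
      unfolding disjoint_family_on_def using dis by (simp add: disjnt_def)
    show "emeasure lebesgue (?J x) \<noteq> \<infinity>" if "x \<in> B" for x
      using that by (cases x) (auto simp: B_def less_imp_le)
  qed
  \<comment> \<open>Each interval of \<open>B\<close> has its tag in \<open>N\<close>, so fineness
    places it inside \<open>U\<close>, whose measure is below \<open>\<eta>\<close>.\<close>
  also have "\<dots> \<le> measure lebesgue U"
  proof (rule measure_mono_fmeasurable[OF _ _ Um])
    show "(\<Union>x\<in>B. ?J x) \<subseteq> U"
    proof clarsimp
      fix s t K assume "(t, K) \<in> B" "Inf K < s" "s < Sup K"
      then show "s \<in> U" using K[of t K] BK[of t K] r(2)[of t]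
        by (metis atLeastAtMost_iff less_imp_le subsetD)
    qed
    show "(\<Union>x\<in>B. ?J x) \<in> sets lebesgue"
      by (intro sets.finite_UN \<open>finite B\<close>) (auto simp: split_def)
  qed
  also note mU
  finally have small: "(\<Sum>(u, v)\<in>?g ` B. v - u) < \<eta>" .
  have "(\<Sum>(u, v)\<in>?g ` B. norm (f v - f u)) < e"
  proof (rule \<eta>(2)[OF _ _ _ small])
    show "finite (?g ` B)" using \<open>finite B\<close> by simp
    show "\<forall>(u, v)\<in>?g ` B. a \<le> u \<and> u \<le> v \<and> v \<le> b"
      using K BK by (auto intro: less_imp_le)
    show "pairwise (\<lambda>p q. disjnt {fst p<..<snd p} {fst q<..<snd q}) (?g ` B)"
      using dis by (fastforce simp: pairwise_def split_def)
  qed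
  then have bad: "(\<Sum>(t, K)\<in>B. \<bar>f (Sup K) - f (Inf K)\<bar>) < e"
    by (subst (asm) sum.reindex[OF inj]) (auto simp: split_def)
  \<comment> \<open>A tag in \<open>N\<close> outside \<open>B\<close> means a single point;
    otherwise the bounds to the left and right of the tag add up.\<close>
  have rest: "- e * (Sup K - Inf K) \<le> f (Sup K) - f (Inf K)" if "(t, K) \<in> p - B" for t K
  proof (cases "t \<in> N")
    case True
    then have "Inf K = Sup K" using that K[of t K] by (force simp: B_def)
    then show ?thesis by simp
  next
    case False
    have tK: "(t, K) \<in> p" using that by auto
    note KK = K[OF tK]
    have "Inf K \<in> ball t (r t)" "Sup K \<in> ball t (r t)"
      using KK by (metis atLeastAtMost_iff order.trans order_refl subsetD)+
    then have "\<bar>Inf K - t\<bar> < r t" "\<bar>Sup K - t\<bar> < r t" by (auto simp: dist_real_def)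
    then have "f (Sup K) - f t \<ge> - e * (Sup K - t)" "f t - f (Inf K) \<ge> - e * (t - Inf K)"
      using r(3)[OF False, of "Sup K"] r(3)[OF False, of "Inf K"] KK by auto
    then show ?thesis by (simp add: algebra_simps)
  qed
  have tot: "(\<Sum>(t, K)\<in>p. Sup K - Inf K) = b - a"
    using additive_tagged_division_1[OF \<open>a \<le> b\<close> p(1), of "\<lambda>x. x"] by simp
  have split: "(\<Sum>x\<in>p. F x) = (\<Sum>x\<in>p - B. F x) + (\<Sum>x\<in>B. F x)" for F :: "_ \<Rightarrow> real"
    using pD(1) by (intro sum.subset_diff) (auto simp: B_def)
  have "- e * (\<Sum>(t, K)\<in>p - B. Sup K - Inf K) \<le> (\<Sum>(t, K)\<in>p - B. f (Sup K) - f (Inf K))"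
    unfolding sum_distrib_left using rest by (intro sum_mono) auto
  moreover have "e * (\<Sum>(t, K)\<in>p - B. Sup K - Inf K) \<le> e * (b - a)"
  proof (rule mult_left_mono)
    have "0 \<le> (\<Sum>(t, K)\<in>B. Sup K - Inf K)"
      using BK by (intro sum_nonneg) (auto intro: less_imp_le)
    then show "(\<Sum>(t, K)\<in>p - B. Sup K - Inf K) \<le> b - a"
      using tot split[of "\<lambda>(t, K). Sup K - Inf K"] by simp
  qed (use e in simp)
  moreover have "- (\<Sum>(t, K)\<in>B. \<bar>f (Sup K) - f (Inf K)\<bar>) \<le> (\<Sum>(t, K)\<in>B. f (Sup K) - f (Inf K))"
    unfolding sum_negf[symmetric] by (intro sum_mono) auto
  moreover have "f b - f a = (\<Sum>(t, K)\<in>p - B. f (Sup K) - f (Inf K)) + (\<Sum>(t, K)\<in>B. f (Sup K) - f (Inf K))"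
    using additive_tagged_division_1[OF \<open>a \<le> b\<close> p(1), of f] split by simp
  ultimately show "f a \<le> f b + e0" using bad ee by simp
qed

section \<open>First zeros and positivity\<close>

lemma abs_cont_subinterval:
  assumes "abs_cont_on_interval a b f" "a \<le> c" "d \<le> b"
  shows "abs_cont_on_interval c d f"
  unfolding abs_cont_on_interval_def
proof (intro allI impI)
  fix e :: real assume "e > 0"
  obtain \<eta> where \<eta>: "\<eta> > 0" "\<And>D :: (real \<times> real) set. finite D \<Longrightarrow>
        (\<forall>(u, v)\<in>D. a \<le> u \<and> u \<le> v \<and> v \<le> b) \<Longrightarrow>
        pairwise (\<lambda>p q. disjnt {fst p<..<snd p} {fst q<..<snd q}) D \<Longrightarrow>
        (\<Sum>(u, v)\<in>D. v - u) < \<eta> \<Longrightarrow> (\<Sum>(u, v)\<in>D. norm (f v - f u)) < e"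
    by (rule abs_cont_on_intervalE[OF assms(1) \<open>e > 0\<close>]) (rule that)
  have sub: "\<forall>(u, v)\<in>D. a \<le> u \<and> u \<le> v \<and> v \<le> b"
    if "\<forall>(u, v)\<in>D. c \<le> u \<and> u \<le> v \<and> v \<le> d" for D
    using that assms(2,3) by fastforce
  show "\<exists>\<eta>>0. \<forall>D. finite D \<longrightarrow> (\<forall>(u, v)\<in>D. c \<le> u \<and> u \<le> v \<and> v \<le> d) \<longrightarrow>
        pairwise (\<lambda>p q. disjnt {fst p<..<snd p} {fst q<..<snd q}) D \<longrightarrow>
        (\<Sum>(u, v)\<in>D. v - u) < \<eta> \<longrightarrow> (\<Sum>(u, v)\<in>D. norm (f v - f u)) < e"
    using \<eta>(1) by (intro exI[of _ \<eta>] conjI allI impI \<eta>(2)[OF _ sub]) auto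
qed

text \<open>The set where \<open>f \<le> 0\<close> is compact and nonempty, so it has a least
  element.\<close>

lemma first_nonpositive:
  fixes f :: "real \<Rightarrow> real"
  assumes "a \<le> b" "continuous_on {a..b} f" "f a > 0" "f b \<le> 0"
  obtains s where "a < s" "s \<le> b" "f s \<le> 0" "\<And>t. a \<le> t \<Longrightarrow> t < s \<Longrightarrow> f t > 0"
proof -
  let ?Z = "{t \<in> {a..b}. f t \<le> 0}"
  have "closed ?Z"
    using assms(2) by (intro continuous_on_closed_Collect_le) auto
  moreover have "bounded ?Z" by (rule bounded_subset[of "{a..b}"]) auto
  ultimately have "compact ?Z" by (simp add: compact_eq_bounded_closed)
  moreover have "?Z \<noteq> {}" using assms by auto
  ultimately obtain s where s: "s \<in> ?Z" "\<And>t. t \<in> ?Z \<Longrightarrow> s \<le> t"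
    using compact_attains_inf[of ?Z] by blast
  show ?thesis
  proof
    show "a < s" using s(1) assms(3) by (cases "s = a") auto
    show "f t > 0" if "a \<le> t" "t < s" for t
      using s(2)[of t] s(1) that by force
  qed (use s in auto)
qed

lemma AE_lebesgue_neq: "AE t in lebesgue. t \<noteq> (s :: 'a :: euclidean_space)"
  by (rule AE_I'[of "{s}"]) auto

text \<open>A Gronwall-type bound: up to a first zero \<open>s\<close>, the function loses at most half of its maximum
  over an interval \<open>[r, s]\<close> of length at most \<open>1 / (2 M)\<close> with \<open>M \<ge> C\<close>.\<close>

lemma abs_cont_positive:
  fixes f :: "real \<Rightarrow> real"
  assumes "a \<le> b" and ac: "abs_cont_on_interval a b f" and "f a > 0"
    and ae: "AE t in lebesgue. t \<in> {a..b} \<and> f t > 0 \<longrightarrow>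
               (\<exists>d. (f has_real_derivative d) (at t within {a..b}) \<and> d \<ge> - (C * f t))"
  shows "f b > 0"
proof (rule ccontr)
  assume "\<not> f b > 0"
  then obtain s where s: "a < s" "s \<le> b" "f s \<le> 0" "\<And>t. a \<le> t \<Longrightarrow> t < s \<Longrightarrow> f t > 0"
    using first_nonpositive[OF \<open>a \<le> b\<close> abs_cont_imp_continuous_on[OF ac] \<open>f a > 0\<close>] by auto
  \<comment> \<open>Strict positivity makes \<open>1 / (2 * M)\<close> a positive length, and
    \<open>C \<le> M\<close> holds for either sign of \<open>C\<close>.\<close>
  define M where "M = \<bar>C\<bar> + 1"
  have M: "M > 0" "C \<le> M" by (auto simp: M_def)
  define r where "r = max a (s - 1 / (2 * M))"
  have r: "a \<le> r" "r < s" "s - r \<le> 1 / (2 * M)" using M s(1) by (auto simp: r_def)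
  have "continuous_on {r..s} f"
    using continuous_on_subset[OF abs_cont_imp_continuous_on[OF ac]] r s by auto
  then obtain p where p: "p \<in> {r..s}" "\<And>t. t \<in> {r..s} \<Longrightarrow> f t \<le> f p"
    using continuous_attains_sup[of "{r..s}" f] r by auto
  have fp: "f p > 0" using p(2)[of r] s(4)[of r] r by auto
  \<comment> \<open>On \<open>[p, s]\<close> the bound \<open>- (C * f t)\<close> is at least the
    constant \<open>- (M * f p)\<close>, as \<open>p\<close> maximizes \<open>f\<close> on
    \<open>[r, s]\<close>. Adding a linear function of that slope makes the derivative
    nonnegative.\<close>
  have "f p + M * f p * p \<le> f s + M * f p * s"
  proof (rule abs_cont_increasing[where f = "\<lambda>t. f t + M * f p * t"])
    show "p \<le> s" using p by auto
    show "abs_cont_on_interval p s (\<lambda>t. f t + M * f p * t)"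
    proof (rule abs_cont_add)
      show "abs_cont_on_interval p s f"
        using abs_cont_subinterval[OF ac] p r s by auto
      show "abs_cont_on_interval p s (\<lambda>t. M * f p * t)"
        using M fp by (intro abs_cont_Lipschitz[of _ _ _ "M * f p"])
          (auto simp: right_diff_distrib[symmetric] abs_mult)
    qed
    show "AE t in lebesgue. t \<in> {p..s} \<longrightarrow>
        (\<exists>d\<ge>0. ((\<lambda>t. f t + M * f p * t) has_real_derivative d) (at t within {p..s}))"
      \<comment> \<open>The endpoint \<open>s\<close> is discarded because
        \<open>f s \<le> 0\<close>, so \<open>ae\<close> gives no derivative bound there.\<close>
      using ae AE_lebesgue_neq[of s]
    proof eventually_elim
      case (elim t)
      show ?case
      proof
        assume t: "t \<in> {p..s}"
        with elim p r s have ft: "f t > 0" by auto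
        then obtain d where d: "(f has_real_derivative d) (at t within {a..b})" "d \<ge> - (C * f t)"
          using elim t p r s by auto
        have "((\<lambda>t. f t + M * f p * t) has_real_derivative d + M * f p) (at t within {p..s})"
          using p r s by (auto intro!: derivative_eq_intros DERIV_subset[OF d(1)])
        moreover have "C * f t \<le> M * f p"
          using M ft p(2)[of t] t p(1) by (intro mult_mono) auto
        ultimately show "\<exists>d\<ge>0. ((\<lambda>t. f t + M * f p * t) has_real_derivative d) (at t within {p..s})"
          using d(2) by (intro exI[of _ "d + M * f p"]) auto
      qed
    qed
  qed
  moreover have "f p * (M * (s - p)) \<le> f p * (1 / 2)"
  proof (rule mult_left_mono)
    have "s - p \<le> 1 / (2 * M)" using r p by auto
    then show "M * (s - p) \<le> 1 / 2" using M by (simp add: field_simps)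
  qed (use fp in auto)
  ultimately show False using fp s(3) by (simp add: algebra_simps)
qed

section \<open>Invariance of the convex set\<close>

theorem lemma2p9:
  fixes \<Omega> :: "(real ^ 'd) set"
    and y x x' :: "real \<Rightarrow> real ^ 'd"
    and \<delta> \<alpha>\<^sub>1 :: "real \<Rightarrow> real"
    and x\<^sub>0 x\<^sub>1 :: "real ^ 'd"
    and t\<^sub>0 :: real
  assumes "t\<^sub>0 \<ge> 0"
    and "\<Omega> \<noteq> {}" "closed \<Omega>" "convex \<Omega>"
    and "\<And>t. t \<ge> t\<^sub>0 \<Longrightarrow> y t \<in> \<Omega>"
    and "\<And>t. t \<ge> t\<^sub>0 \<Longrightarrow> \<delta> t > 0"
    and "\<And>t. t \<ge> t\<^sub>0 \<Longrightarrow> \<alpha>\<^sub>1 t > 0"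
    and "loc_abs_cont_from t\<^sub>0 y"
    and "loc_abs_cont_from t\<^sub>0 \<delta>"
    and "loc_abs_cont_from t\<^sub>0 \<alpha>\<^sub>1"
    and "damping_condition t\<^sub>0 \<alpha>\<^sub>1 \<delta>"
    and "x\<^sub>0 \<in> \<Omega>" "x\<^sub>1 \<in> \<Omega>"
    and "ode_solution t\<^sub>0 \<alpha>\<^sub>1 \<delta> y x x'"
    and "x t\<^sub>0 = x\<^sub>0"
    and "x' t\<^sub>0 = (1/4 * \<alpha>\<^sub>1 t\<^sub>0) *\<^sub>R (x\<^sub>1 - x\<^sub>0)"
  shows "\<forall>t\<ge>t\<^sub>0. x t \<in> \<Omega>"
proof (rule ccontr)
  assume "\<not> (\<forall>t\<ge>t\<^sub>0. x t \<in> \<Omega>)"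
  then obtain \<tau> where \<tau>: "\<tau> \<ge> t\<^sub>0" "x \<tau> \<notin> \<Omega>" by auto
  obtain c \<beta> where c: "c \<bullet> x \<tau> < \<beta>" "\<And>z. z \<in> \<Omega> \<Longrightarrow> c \<bullet> z > \<beta>"
    using separating_hyperplane_closed_point[OF \<open>convex \<Omega>\<close> \<open>closed \<Omega>\<close> \<tau>(2)] by blast
  note y = assms(5) and \<delta> = assms(6) and \<alpha> = assms(7)
  have x_deriv: "\<And>t. t \<ge> t\<^sub>0 \<Longrightarrow> (x has_vector_derivative x' t) (at t within {t\<^sub>0..})"
    and x'_ac: "loc_abs_cont_from t\<^sub>0 x'"
    and ode: "AE t in lebesgue. t \<ge> t\<^sub>0 \<longrightarrow>
        (\<exists>x''. (x' has_vector_derivative x'') (at t within {t\<^sub>0..}) \<and>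
               x'' + \<alpha>\<^sub>1 t *\<^sub>R x' t = \<delta> t *\<^sub>R (y t - x t))"
    using \<open>ode_solution t\<^sub>0 \<alpha>\<^sub>1 \<delta> y x x'\<close> unfolding ode_solution_def by blast+
  note damp = \<open>damping_condition t\<^sub>0 \<alpha>\<^sub>1 \<delta>\<close>[unfolded damping_condition_def]
  define u where "u t = c \<bullet> x t - \<beta>" for t
  define u' where "u' t = c \<bullet> x' t" for t
  \<comment> \<open>If \<open>E\<close> is the exponential of half the integral of
    \<open>\<alpha>\<^sub>1\<close> from \<open>t\<^sub>0\<close>, then \<open>(E u)' = E v\<close>,
    and the damping condition makes \<open>(E v)'\<close> positive almost everywhere on the set
    where \<open>u\<close> is positive.\<close>
  define v where "v t = u' t + 1/2 * \<alpha>\<^sub>1 t * u t" for t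
  have u_deriv: "(u has_real_derivative u' t) (at t within {t\<^sub>0..})" if "t \<ge> t\<^sub>0" for t
    unfolding u_def u'_def has_real_derivative_iff_has_vector_derivative
    using bounded_linear.has_vector_derivative[OF bounded_linear_inner_right[of c] x_deriv[OF that]]
    by (auto intro!: derivative_eq_intros)
  have u0: "u t\<^sub>0 > 0" using c(2)[OF assms(12)] assms(15) by (simp add: u_def)
  have v0: "v t\<^sub>0 > 0"
  proof -
    \<comment> \<open>The factor 1/4 in the initial velocity makes \<open>v t\<^sub>0\<close> equal
      to half of \<open>\<alpha>\<^sub>1 t\<^sub>0\<close> times the value of
      \<open>c \<bullet> z - \<beta>\<close> at the midpoint \<open>z\<close> of
      \<open>x\<^sub>0\<close> and \<open>x\<^sub>1\<close>.\<close>
    have "v t\<^sub>0 = 1/4 * \<alpha>\<^sub>1 t\<^sub>0 * (c \<bullet> x\<^sub>1 - \<beta> + u t\<^sub>0)"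
      by (simp add: v_def u'_def u_def assms(15,16) inner_diff_right field_simps)
    moreover have "1/4 * \<alpha>\<^sub>1 t\<^sub>0 * (c \<bullet> x\<^sub>1 - \<beta> + u t\<^sub>0) > 0"
      using c(2)[OF assms(13)] \<alpha>[of t\<^sub>0] u0 by (intro mult_pos_pos) auto
    ultimately show ?thesis by simp
  qed
  have cont: "continuous_on {t\<^sub>0..\<tau>} u"
    by (rule DERIV_continuous_on[OF DERIV_subset[OF u_deriv]]) auto
  have "u \<tau> \<le> 0" using c by (simp add: u_def)
  then obtain T where T: "t\<^sub>0 < T" "u T \<le> 0" "\<And>t. t\<^sub>0 \<le> t \<Longrightarrow> t < T \<Longrightarrow> u t > 0"
    using first_nonpositive[OF \<tau>(1) cont u0] by blast
  have \<alpha>_ac: "abs_cont_on_interval t\<^sub>0 T \<alpha>\<^sub>1"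
    using \<open>loc_abs_cont_from t\<^sub>0 \<alpha>\<^sub>1\<close> T by (auto simp: loc_abs_cont_from_def)
  have u'_ac: "abs_cont_on_interval t\<^sub>0 T u'"
    unfolding u'_def using x'_ac T by (intro abs_cont_inner_left) (auto simp: loc_abs_cont_from_def)
  obtain B where B: "\<And>t. t \<in> {t\<^sub>0..T} \<Longrightarrow> \<bar>u' t\<bar> \<le> B"
    using abs_cont_bounded[OF u'_ac] by auto
  obtain A where A: "\<And>t. t \<in> {t\<^sub>0..T} \<Longrightarrow> \<bar>\<alpha>\<^sub>1 t\<bar> \<le> A"
    using abs_cont_bounded[OF \<alpha>_ac] by auto
  have u_deriv_T: "(u has_real_derivative u' t) (at t within {t\<^sub>0..T})" if "t \<in> {t\<^sub>0..T}" for t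
    by (rule DERIV_subset[OF u_deriv]) (use that in auto)
  \<comment> \<open>The derivative \<open>u'\<close> is continuous, hence bounded on the compact
    interval, so \<open>u\<close> is Lipschitz there.\<close>
  have u_ac: "abs_cont_on_interval t\<^sub>0 T u"
  proof (rule abs_cont_Lipschitz)
    fix r s assume rs: "t\<^sub>0 \<le> r" "r \<le> s" "s \<le> T"
    have "norm (u s - u r) \<le> B * norm (s - r)"
      by (rule field_differentiable_bound[of "{t\<^sub>0..T}", OF _ u_deriv_T]) (use B rs in auto)
    then show "norm (u s - u r) \<le> B * (s - r)" using rs by simp
  qed
  have v_ac: "abs_cont_on_interval t\<^sub>0 T v"
    unfolding v_def
  proof (intro abs_cont_add abs_cont_mult u'_ac \<alpha>_ac u_ac)
    show "abs_cont_on_interval t\<^sub>0 T (\<lambda>t. 1/2 :: real)"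
      by (rule abs_cont_Lipschitz[of _ _ _ 0]) auto
  qed
  have v_pos: "v s > 0" if s: "t\<^sub>0 \<le> s" "s \<le> T" for s
  proof (rule abs_cont_positive[OF s(1)])
    show "abs_cont_on_interval t\<^sub>0 s v" by (rule abs_cont_subinterval[OF v_ac]) (use s in auto)
    show "AE t in lebesgue. t \<in> {t\<^sub>0..s} \<and> v t > 0 \<longrightarrow>
        (\<exists>d. (v has_real_derivative d) (at t within {t\<^sub>0..s}) \<and> d \<ge> - (A/2 * v t))"
      \<comment> \<open>At \<open>T\<close> the sign of \<open>u\<close> is lost; excluding that
        point keeps \<open>u t > 0\<close>, which the damping inequality is multiplied by.\<close>
      using ode damp AE_lebesgue_neq[of T]
    proof eventually_elim
      case (elim t)
      show ?case
      proof
        assume t: "t \<in> {t\<^sub>0..s} \<and> v t > 0"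
        have ut: "u t > 0" using T(3)[of t] t s elim by auto
        obtain x'' where x'': "(x' has_vector_derivative x'') (at t within {t\<^sub>0..})"
            "x'' + \<alpha>\<^sub>1 t *\<^sub>R x' t = \<delta> t *\<^sub>R (y t - x t)"
          using elim t by auto
        define a' where "a' = vector_derivative \<alpha>\<^sub>1 (at t within {t\<^sub>0..})"
        have a': "(\<alpha>\<^sub>1 has_real_derivative a') (at t within {t\<^sub>0..})"
            "\<delta> t < 1/4 * ((\<alpha>\<^sub>1 t)\<^sup>2 + 2 * a')"
          using elim t
          by (auto simp: a'_def has_real_derivative_iff_has_vector_derivative vector_derivative_works)
        have u'_deriv: "(u' has_real_derivative c \<bullet> x'') (at t within {t\<^sub>0..})"
          unfolding u'_def has_real_derivative_iff_has_vector_derivative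
          by (rule bounded_linear.has_vector_derivative[OF bounded_linear_inner_right x''(1)])
        define d where "d = c \<bullet> x'' + 1/2 * (a' * u t + u' t * \<alpha>\<^sub>1 t)"
        have "(v has_real_derivative d) (at t within {t\<^sub>0..})"
          unfolding v_def d_def using t
          by (auto intro!: derivative_eq_intros u'_deriv a'(1) u_deriv simp: algebra_simps)
        then have "(v has_real_derivative d) (at t within {t\<^sub>0..s})"
          by (rule DERIV_subset) auto
        moreover have "d \<ge> - (A/2 * v t)"
        proof -
          have "c \<bullet> x'' + \<alpha>\<^sub>1 t * u' t = \<delta> t * (c \<bullet> y t - \<beta> - u t)"
            using arg_cong[OF x''(2), of "inner c"]
            by (simp add: inner_add_right inner_diff_right u'_def u_def)
          also have "\<dots> \<ge> - (\<delta> t * u t)"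
            using c(2)[OF y, of t] \<delta>[of t] t by (simp add: right_diff_distrib)
          finally have "c \<bullet> x'' \<ge> - (\<delta> t * u t) - \<alpha>\<^sub>1 t * u' t" by simp
          moreover have "\<delta> t * u t \<le> 1/4 * ((\<alpha>\<^sub>1 t)\<^sup>2 + 2 * a') * u t"
            using a'(2) ut by (intro mult_right_mono) auto
          \<comment> \<open>The terms in \<open>a'\<close> cancel, and the remaining terms in
            \<open>u'\<close> and \<open>u\<close> combine into a multiple of
            \<open>v\<close>.\<close>
          ultimately have "d \<ge> - (\<alpha>\<^sub>1 t / 2 * v t)"
            by (simp add: d_def v_def algebra_simps power2_eq_square)
          \<comment> \<open>\<open>abs_cont_positive\<close> takes a constant coefficient; passing
            from \<open>\<alpha>\<^sub>1 t\<close> to its bound \<open>A\<close> is valid because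
            \<open>v t > 0\<close>.\<close>
          moreover have "\<alpha>\<^sub>1 t / 2 * v t \<le> A / 2 * v t"
            using A[of t] t s by (intro mult_right_mono) auto
          ultimately show ?thesis by linarith
        qed
        ultimately show "\<exists>d. (v has_real_derivative d) (at t within {t\<^sub>0..s}) \<and> d \<ge> - (A/2 * v t)"
          by blast
      qed
    qed
  qed (rule v0)
  have "u T > 0"
  proof (rule abs_cont_positive[OF _ u_ac u0])
    have "u' t \<ge> - (A/2 * u t)" if t: "t \<in> {t\<^sub>0..T}" "u t > 0" for t
    proof -
      have "\<alpha>\<^sub>1 t / 2 * u t \<le> A / 2 * u t"
        using A[of t] t by (intro mult_right_mono) auto
      moreover have "u' t = v t - \<alpha>\<^sub>1 t / 2 * u t" by (simp add: v_def)
      moreover have "v t > 0" using v_pos t by simp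
      ultimately show ?thesis by linarith
    qed
    then show "AE t in lebesgue. t \<in> {t\<^sub>0..T} \<and> u t > 0 \<longrightarrow>
        (\<exists>d. (u has_real_derivative d) (at t within {t\<^sub>0..T}) \<and> d \<ge> - (A/2 * u t))"
      using u_deriv_T by (intro AE_I2) blast
  qed (use T in simp)
  with T(2) show False by simp
qed

end
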